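(* Let $V$ be a finite set, let $A, M \subseteq V$ be disjoint, and let $L \subseteq M$. Write $MA = M \cup A$. (i) There is a smooth real-valued function $f$ (depending only on $A$, $M$, $L$) such that for every strictly positive distribution $p_V$ of the binary random vector $X_V$, $$\lambda_L^{MA} = \lambda_L^{M} + f(\boldsymbol\lambda_{A|M}),$$ where $\boldsymbol\lambda_{A|M} = (\lambda_K^{MA} : K \subseteq A \cup M,\ K \cap A \neq \emptyset)$. Moreover, $f(\boldsymbol\lambda_{A|M})$ vanishes whenever $X_A$ is conditionally independent of $X_v$ given $X_{M\setminus\{v\}}$ under $p_V$ for some $v \in L$. (ii) If in addition $L \neq \emptyset$, then for every $K \subseteq V$ with $K \cap (V \setminus M) \neq \emptyset$, $$\frac{\partial \lambda_L^{M}}{\partial \eta_K} = 2^{-|M|} \sum_{x_V \in \{0,1\}^V} (-1)^{|x_{K \triangle L}|}\, p(x_{V \setminus M} \mid x_M),$$ where the partial derivative is taken in the coordinates $(\eta_J : \emptyset \neq J \subseteq V)$ on the set of strictly positive distributions, i.e. with all $\eta_J$, $J \neq K$, held fixed.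
   Context: $V$ is a finite set and $X_V = (X_v)_{v\in V}$ is a vector of binary random variables, $X_v \in \{0,1\}$, with strictly positive joint distribution $p_V(x_V) = P(X_V = x_V) > 0$. For $M \subseteq V$, $p_M(x_M) = p(x_M)$ is the marginal distribution of $X_M = (X_v)_{v\in M}$; for disjoint $A,B$, $p(x_A \mid x_B) = P(X_A = x_A \mid X_B = x_B)$. For $x_V \in \{0,1\}^V$ and $L \subseteq V$, $x_L$ is the restriction of $x_V$ to $L$ and $|x_L| = \sum_{v\in L} x_v$. $K\triangle L$ is the symmetric difference. Marginal log-linear parameters: for $L \subseteq M \subseteq V$, $$\lambda_L^M = 2^{-|M|} \sum_{x_M \in \{0,1\}^M} (-1)^{|x_L|} \log p_M(x_M).$$ The (ordinary) log-linear parameters are $\eta_L = \lambda_L^V$, so that $\log p_V(x_V) = \sum_{L \subseteq V} (-1)^{|x_L|}\eta_L$. The collection $(\eta_J : \emptyset \ne J \subseteq V)$ is a global smooth coordinate system, with range $\mathbb{R}^{2^{|V|}-1}$, on the set of strictly positive distributions $p_V$ ($\eta_\emptyset$ being determined by normalization). *)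

theory Defs
  imports "HOL-Probability.Probability"
begin

(* A binary random vector X_V is given by its law, a pmf on configurations 'v \<Rightarrow> nat.
   The support condition below says both that the law lives on {0,1}^V
   (extensional functions) and that it is strictly positive there. *)

definition configs :: "'v set \<Rightarrow> ('v \<Rightarrow> nat) set" where
  "configs V = V \<rightarrow>\<^sub>E {0, 1}"

definition pos_dists :: "'v set \<Rightarrow> ('v \<Rightarrow> nat) pmf set" where
  "pos_dists V = {p. set_pmf p = configs V}"

(* The event X_S = x_S, where x_S is the restriction to S of a configuration x
   that may be defined on a larger set. *)
abbreviation agree :: "'v set \<Rightarrow> ('v \<Rightarrow> nat) \<Rightarrow> ('v \<Rightarrow> nat) \<Rightarrow> bool" where
  "agree S x y \<equiv> (\<forall>v\<in>S. y v = x v)"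

definition marginal :: "('v \<Rightarrow> nat) pmf \<Rightarrow> 'v set \<Rightarrow> ('v \<Rightarrow> nat) \<Rightarrow> real" where
  "marginal p S x = \<P>(y in measure_pmf p. agree S x y)"

(* p(x_A | x_B) *)
definition conditional ::
    "('v \<Rightarrow> nat) pmf \<Rightarrow> 'v set \<Rightarrow> 'v set \<Rightarrow> ('v \<Rightarrow> nat) \<Rightarrow> real" where
  "conditional p A B x = \<P>(y in measure_pmf p. agree A x y \<bar> agree B x y)"

(* X_A is independent of X_B given X_C.  Where P(X_C = x_C) = 0, both sides are 0. *)
definition cond_indep ::
    "('v \<Rightarrow> nat) pmf \<Rightarrow> 'v set \<Rightarrow> 'v set \<Rightarrow> 'v set \<Rightarrow> bool" where
  "cond_indep p A B C \<longleftrightarrow>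
     (\<forall>x. conditional p (A \<union> B) C x = conditional p A C x * conditional p B C x)"

(* (-1)^|x_L| *)
definition par_sign :: "'v set \<Rightarrow> ('v \<Rightarrow> nat) \<Rightarrow> real" where
  "par_sign L x = (-1) ^ (\<Sum>v\<in>L. x v)"

(* mll p M L is \<lambda>_L^M, for L \<subseteq> M *)
definition mll :: "('v \<Rightarrow> nat) pmf \<Rightarrow> 'v set \<Rightarrow> 'v set \<Rightarrow> real" where
  "mll p M L = (\<Sum>x\<in>configs M. par_sign L x * ln (marginal p M x)) / 2 ^ card M"

(* For an index set I, the space R^I is the set I \<rightarrow>\<^sub>E UNIV of extensional functions. *)

definition has_partial_derivative ::
    "(('i \<Rightarrow> real) \<Rightarrow> real) \<Rightarrow> 'i \<Rightarrow> real \<Rightarrow> ('i \<Rightarrow> real) \<Rightarrow> bool" where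
  "has_partial_derivative f i D x \<longleftrightarrow>
     ((\<lambda>t. f (x(i := t))) has_real_derivative D) (at (x i))"

(* C^k on R^I for finite I: all partial derivatives up to order k exist and are continuous
   (with respect to the product topology, the Euclidean one on R^I). *)
primrec Ck :: "nat \<Rightarrow> 'i set \<Rightarrow> (('i \<Rightarrow> real) \<Rightarrow> real) \<Rightarrow> bool" where
  "Ck 0 I f \<longleftrightarrow> continuous_on (I \<rightarrow>\<^sub>E UNIV) f"
| "Ck (Suc k) I f \<longleftrightarrow> continuous_on (I \<rightarrow>\<^sub>E UNIV) f \<and>
     (\<forall>i\<in>I. \<exists>g. (\<forall>x\<in>I \<rightarrow>\<^sub>E UNIV. has_partial_derivative f i (g x) x) \<and> Ck k I g)"

definition smooth :: "'i set \<Rightarrow> (('i \<Rightarrow> real) \<Rightarrow> real) \<Rightarrow> bool" where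
  "smooth I f \<longleftrightarrow> (\<forall>k. Ck k I f)"

definition cond_indices :: "'v set \<Rightarrow> 'v set \<Rightarrow> 'v set set" where
  "cond_indices A M = {K. K \<subseteq> A \<union> M \<and> K \<inter> A \<noteq> {}}"

(* The vector \<lambda>_{A|M}, an element of R^(cond_indices A M) *)
definition cond_params ::
    "('v \<Rightarrow> nat) pmf \<Rightarrow> 'v set \<Rightarrow> 'v set \<Rightarrow> 'v set \<Rightarrow> real" where
  "cond_params p A M = (\<lambda>K\<in>cond_indices A M. mll p (M \<union> A) K)"

(* The coordinate map p \<mapsto> (\<eta>_J : {} \<noteq> J \<subseteq> V), and its inverse on the strictly positive
   distributions.  The map is a bijection from pos_dists V onto the extensional functions
   on the nonempty subsets of V, so the inverse is defined at every such function. *)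
definition eta_coords :: "'v set \<Rightarrow> ('v \<Rightarrow> nat) pmf \<Rightarrow> 'v set \<Rightarrow> real" where
  "eta_coords V p = (\<lambda>J\<in>Pow V - {{}}. mll p V J)"

definition dist_of_eta :: "'v set \<Rightarrow> ('v set \<Rightarrow> real) \<Rightarrow> ('v \<Rightarrow> nat) pmf" where
  "dist_of_eta V = the_inv_into (pos_dists V) (eta_coords V)"

end

(* The parameters mll p M L are the Walsh coefficients of ln (marginal p M).  Splitting the
   Walsh expansion of the log-joint over M \<union> A at the sets meeting A and summing out x_A gives
   ln p(x_M) = (expansion over K \<subseteq> M) + ln Z(x_M), where Z depends only on the parameters of
   sets meeting A; thus f is minus the L-th Walsh coefficient of ln Z.  It is also the L-th Walsh
   coefficient of ln p(x_A | x_M), which is killed by flipping x_v when X_A is independent of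
   X_v.  For (ii), moving the coordinate \<eta>_K by s tilts the law by exp (s * (-1)^|x_K|), up to
   a normalizing constant that a nonempty L does not see. *)
theory Submission
  imports Defs
begin

section \<open>The Walsh transform on binary configurations\<close>

lemma finite_configs: "finite S \<Longrightarrow> finite (configs S)"
  by (simp add: configs_def finite_PiE)

lemma configs_nonempty: "configs S \<noteq> {}"
  by (simp add: configs_def PiE_eq_empty_iff)

lemma configs_values: "x \<in> configs S \<Longrightarrow> v \<in> S \<Longrightarrow> x v = 0 \<or> x v = 1"
  by (auto simp: configs_def dest: PiE_mem)

lemma configs_eqI: "x \<in> configs S \<Longrightarrow> y \<in> configs S \<Longrightarrow> agree S x y \<Longrightarrow> y = x"
  by (auto simp: configs_def intro: PiE_ext)

lemma restrict_configs: "x \<in> configs N \<Longrightarrow> M \<subseteq> N \<Longrightarrow> restrict x M \<in> configs M"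
  using configs_values[of x N] by (auto simp: configs_def subset_iff)

lemma restrict_eq_iff_agree: "x \<in> configs M \<Longrightarrow> restrict z M = x \<longleftrightarrow> agree M x z"
  by (auto simp: configs_def fun_eq_iff PiE_def extensional_def)

lemma configs_extend:
  assumes "x \<in> configs M" "M \<subseteq> N"
  obtains z where "z \<in> configs N" "agree M x z"
proof
  show "(\<lambda>v\<in>N. if v \<in> M then x v else 0) \<in> configs N"
    using configs_values[OF assms(1)] assms(2) by (auto simp: configs_def)
  show "agree M x (\<lambda>v\<in>N. if v \<in> M then x v else 0)"
    using assms(2) by auto
qed

text \<open>Restriction to \<open>M\<close> maps \<open>configs N\<close> into
  \<open>configs M\<close>, and its fibres partition \<open>configs N\<close>.\<close>

lemma sum_configs_fibres:
  assumes "finite N" "M \<subseteq> N"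
  shows "(\<Sum>x\<in>configs M. \<Sum>z | z \<in> configs N \<and> agree M x z. h z) = (\<Sum>z\<in>configs N. h z)"
proof -
  have "finite M" using assms finite_subset by blast
  have "(\<Sum>x\<in>configs M. \<Sum>z | z \<in> configs N \<and> agree M x z. h z)
      = (\<Sum>x\<in>configs M. \<Sum>z | z \<in> configs N \<and> restrict z M = x. h z)"
    by (intro sum.cong refl) (auto simp: restrict_eq_iff_agree)
  also have "\<dots> = (\<Sum>z\<in>configs N. h z)"
    using assms \<open>finite M\<close> by (intro sum.group) (auto simp: finite_configs intro: restrict_configs)
  finally show ?thesis .
qed

section \<open>Signs as characters on binary configurations, and their Walsh coefficients\<close>

lemma par_sign_cong: "agree L x y \<Longrightarrow> par_sign L y = par_sign L x"
  by (simp add: par_sign_def)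

lemma par_sign_square: "par_sign L x * par_sign L x = 1"
  by (simp add: par_sign_def flip: power_mult_distrib)

lemma par_sign_prod: "par_sign L x = (\<Prod>v\<in>L. (-1) ^ x v)"
  by (simp add: par_sign_def power_sum)

lemma par_sign_empty [simp]: "par_sign {} x = 1"
  by (simp add: par_sign_def)

text \<open>The coordinates in \<open>K \<inter> L\<close> contribute their sign twice to the
  product, and the square of a sign is 1.\<close>

lemma par_sign_sym_diff:
  assumes "finite K" "finite L"
  shows "par_sign (sym_diff K L) x = par_sign K x * par_sign L x"
proof -
  have split: "par_sign S x = par_sign (S - T) x * par_sign (S \<inter> T) x" if "finite S" for S T
    unfolding par_sign_prod using that
    by (subst prod.union_disjoint[symmetric]) (auto intro: prod.cong)
  have "par_sign (sym_diff K L) x = par_sign (K - L) x * par_sign (L - K) x"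
    unfolding par_sign_prod using assms by (intro prod.union_disjoint) auto
  also have "\<dots> = par_sign (K - L) x * par_sign (L - K) x
      * (par_sign (K \<inter> L) x * par_sign (K \<inter> L) x)"
    by (simp add: par_sign_square)
  also have "\<dots> = par_sign K x * par_sign L x"
    using split[of K L] split[of L K] assms by (simp add: Int_commute mult.commute mult.left_commute)
  finally show ?thesis .
qed

text \<open>The Fourier coefficient at the character \<open>par_sign K\<close>, scaled so that the
  characters are orthonormal. Since \<open>g\<close> takes arbitrary functions as arguments, the
  same \<open>g\<close> can be transformed over different index sets.\<close>

definition walsh :: "'v set \<Rightarrow> (('v \<Rightarrow> nat) \<Rightarrow> real) \<Rightarrow> 'v set \<Rightarrow> real" where
  "walsh N g K = (\<Sum>x\<in>configs N. par_sign K x * g x) / 2 ^ card N"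

lemma mll_walsh: "mll p M L = walsh M (\<lambda>x. ln (marginal p M x)) L"
  by (simp add: mll_def walsh_def)

lemma walsh_cong: "(\<And>x. x \<in> configs N \<Longrightarrow> g x = h x) \<Longrightarrow> walsh N g K = walsh N h K"
  by (simp add: walsh_def)

lemma walsh_add: "walsh N (\<lambda>x. g x + h x) K = walsh N g K + walsh N h K"
  by (simp add: walsh_def sum.distrib add_divide_distrib distrib_left)

lemma walsh_cmult: "walsh N (\<lambda>x. c * g x) K = c * walsh N g K"
  by (simp add: walsh_def sum_distrib_left mult.left_commute)

lemma walsh_sum: "walsh N (\<lambda>x. \<Sum>i\<in>I. g i x) K = (\<Sum>i\<in>I. walsh N (g i) K)"
  unfolding walsh_def by (subst sum_divide_distrib[symmetric]) (simp add: sum_distrib_left sum.swap[of _ I])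

lemma walsh_diff: "walsh N (\<lambda>x. g x - h x) K = walsh N g K - walsh N h K"
  by (simp add: walsh_def sum_subtractf diff_divide_distrib right_diff_distrib)

text \<open>Flipping coordinate \<open>v\<close> is an involution of \<open>configs N\<close> that
  fixes \<open>g\<close> and negates \<open>par_sign L\<close>, so the sum equals its own
  negative.\<close>

lemma walsh_independent_eq_0:
  assumes "finite N" "L \<subseteq> N" "v \<in> L"
    and indep: "\<And>x y. x \<in> configs N \<Longrightarrow> y \<in> configs N \<Longrightarrow> agree (N - {v}) x y \<Longrightarrow> g y = g x"
  shows "walsh N g L = 0"
proof -
  have "finite L" using assms finite_subset by blast
  \<comment> \<open>Subtraction on naturals truncates, so \<open>1 - x v\<close> swaps 0 and 1 but
    is an involution only on binary values; this is why \<open>inv\<close> is restricted to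
    configurations.\<close>
  define flip where "flip = (\<lambda>x::'a \<Rightarrow> nat. x(v := 1 - x v))"
  have mem: "flip x \<in> configs N" if "x \<in> configs N" for x
    using that assms by (auto simp: flip_def configs_def PiE_def Pi_def extensional_def)
  have inv: "flip (flip x) = x" if "x \<in> configs N" for x
  proof -
    have "v \<in> N" using assms by auto
    from configs_values[OF that this] show ?thesis by (auto simp: flip_def)
  qed
  have sign: "par_sign L (flip x) = - par_sign L x" if "x \<in> configs N" for x
  proof -
    have "par_sign L y = (-1) ^ y v * par_sign (L - {v}) y" for y
      unfolding par_sign_prod using \<open>finite L\<close> \<open>v \<in> L\<close> by (rule prod.remove)
    moreover have "par_sign (L - {v}) (flip x) = par_sign (L - {v}) x"
      by (rule par_sign_cong) (simp add: flip_def)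
    moreover have "(-1::real) ^ flip x v = - ((-1) ^ x v)"
    proof -
      have "v \<in> N" using assms by auto
      from configs_values[OF that this] show ?thesis by (auto simp: flip_def)
    qed
    ultimately show ?thesis by simp
  qed
  have "(\<Sum>x\<in>configs N. par_sign L x * g x) = (\<Sum>x\<in>configs N. - (par_sign L x * g x))"
  proof (rule sum.reindex_bij_witness[of _ flip flip])
    fix x assume x: "x \<in> configs N"
    have "g (flip x) = g x"
      by (rule indep[OF x mem[OF x]]) (simp add: flip_def)
    then show "- (par_sign L (flip x) * g (flip x)) = par_sign L x * g x"
      by (simp add: sign[OF x])
  qed (auto simp: mem inv)
  then show ?thesis
    by (simp add: walsh_def sum_negf)
qed

lemma card_configs: "finite N \<Longrightarrow> card (configs N) = 2 ^ card N"
  by (simp add: configs_def card_PiE numeral_2_eq_2)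

text \<open>Orthonormality of the characters: for distinct sets the product of the two signs is the
  sign of a nonempty symmetric difference, and a constant function has coefficient 0 there.\<close>

lemma walsh_par_sign:
  assumes "finite N" "J \<subseteq> N" "K \<subseteq> N"
  shows "walsh N (par_sign J) K = (if J = K then 1 else 0)"
proof (cases "J = K")
  case True
  then show ?thesis
    using assms by (simp add: walsh_def par_sign_square card_configs)
next
  case False
  then obtain v where "v \<in> sym_diff K J" by auto
  have fin: "finite K" "finite J" using assms finite_subset by blast+
  have "walsh N (par_sign J) K = walsh N (\<lambda>_. 1) (sym_diff K J)"
    by (simp add: walsh_def par_sign_sym_diff[OF fin])
  also have "\<dots> = 0"
    using assms \<open>v \<in> sym_diff K J\<close> by (intro walsh_independent_eq_0[of N _ v]) auto
  finally show ?thesis using False by simp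
qed

lemma walsh_const:
  assumes "finite N" "K \<subseteq> N" "K \<noteq> {}"
  shows "walsh N (\<lambda>_. c) K = 0"
proof -
  obtain v where "v \<in> K" using assms by auto
  then show ?thesis using assms by (intro walsh_independent_eq_0[of N _ v]) auto
qed

text \<open>The dual orthogonality. The sum over subsets is the expansion of a product of two-term
  factors, one per coordinate; a factor is 2 where \<open>x\<close> and \<open>y\<close> agree and 0
  where they differ.\<close>

lemma sum_par_sign_mult:
  assumes "finite N" "x \<in> configs N" "y \<in> configs N"
  shows "(\<Sum>K\<in>Pow N. par_sign K x * par_sign K y) = (if x = y then 2 ^ card N else 0)"
proof -
  have "(\<Sum>K\<in>Pow N. par_sign K x * par_sign K y)
      = (\<Sum>K\<in>Pow N. (\<Prod>v\<in>K. (-1) ^ x v * (-1) ^ y v) * (\<Prod>v\<in>N - K. 1))"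
    by (simp add: par_sign_prod prod.distrib)
  also have "\<dots> = (\<Prod>v\<in>N. (-1) ^ x v * (-1) ^ y v + 1)"
    using assms(1) by (rule prod_add[symmetric])
  also have "\<dots> = (\<Prod>v\<in>N. if x v = y v then 2 else (0::real))"
  proof (rule prod.cong)
    fix v assume "v \<in> N"
    then show "(-1) ^ x v * (-1) ^ y v + 1 = (if x v = y v then 2 else (0::real))"
      using configs_values[OF assms(2), of v] configs_values[OF assms(3), of v] by auto
  qed simp
  also have "\<dots> = (if x = y then 2 ^ card N else 0)"
  proof (cases "x = y")
    case False
    then obtain v where "v \<in> N" "x v \<noteq> y v"
      using configs_eqI[OF assms(2,3)] by force
    then show ?thesis using assms(1) False by auto
  qed simp
  finally show ?thesis .
qed

text \<open>Interchanging the two sums leaves, by dual orthogonality, only the term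
  \<open>y = x\<close>, with weight \<open>2 ^ card N\<close>.\<close>

lemma walsh_inversion:
  assumes "finite N" "x \<in> configs N"
  shows "g x = (\<Sum>K\<in>Pow N. par_sign K x * walsh N g K)"
proof -
  have "(\<Sum>K\<in>Pow N. par_sign K x * walsh N g K)
      = (\<Sum>K\<in>Pow N. \<Sum>y\<in>configs N. par_sign K x * par_sign K y * g y) / 2 ^ card N"
    unfolding walsh_def by (simp add: sum_divide_distrib sum_distrib_left mult.assoc)
  also have "\<dots> = (\<Sum>y\<in>configs N. (\<Sum>K\<in>Pow N. par_sign K x * par_sign K y) * g y) / 2 ^ card N"
    by (subst sum.swap) (simp add: sum_distrib_right)
  also have "\<dots> = (\<Sum>y\<in>configs N. if x = y then 2 ^ card N * g y else 0) / 2 ^ card N"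
    using assms by (intro arg_cong2[where f="(/)"] sum.cong refl) (simp add: sum_par_sign_mult)
  also have "\<dots> = g x"
    using assms by (simp add: finite_configs)
  finally show ?thesis by simp
qed

text \<open>Uniqueness of the expansion: orthonormality reads the coefficients off any sum of
  characters, including the value 0 at sets that do not occur in it.\<close>

lemma walsh_expansion:
  assumes "finite N" "\<K> \<subseteq> Pow N" "L \<subseteq> N"
  shows "walsh N (\<lambda>x. \<Sum>K\<in>\<K>. par_sign K x * c K) L = (if L \<in> \<K> then c L else 0)"
proof -
  have fin: "finite \<K>" using assms finite_subset by blast
  have "walsh N (\<lambda>x. \<Sum>K\<in>\<K>. par_sign K x * c K) L = (\<Sum>K\<in>\<K>. c K * walsh N (par_sign K) L)"
    by (simp add: walsh_sum mult.commute[of _ "c _"] walsh_cmult)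
  also have "\<dots> = (\<Sum>K\<in>\<K>. if K = L then c K else 0)"
  proof (rule sum.cong)
    fix K assume "K \<in> \<K>"
    then have "K \<subseteq> N" using assms by auto
    then show "c K * walsh N (par_sign K) L = (if K = L then c K else 0)"
      using assms by (simp add: walsh_par_sign)
  qed simp
  also have "\<dots> = (if L \<in> \<K> then c L else 0)"
    using fin by simp
  finally show ?thesis .
qed

text \<open>The expansion of \<open>g\<close> over \<open>M\<close> is also valid on
  \<open>configs N\<close>, because \<open>g\<close> sees only the coordinates in \<open>M\<close>;
  uniqueness then identifies the coefficients. This places parameters of different margins in one
  transform.\<close>

lemma walsh_superset:
  assumes "finite N" "M \<subseteq> N" "L \<subseteq> M"
    and local: "\<And>x z. agree M x z \<Longrightarrow> g z = g x"
  shows "walsh N g L = walsh M g L"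
proof -
  have "finite M" using assms finite_subset by blast
  have "g z = (\<Sum>K\<in>Pow M. par_sign K z * walsh M g K)" if "z \<in> configs N" for z
  proof -
    have "g z = g (restrict z M)" by (rule local) simp
    also have "\<dots> = (\<Sum>K\<in>Pow M. par_sign K (restrict z M) * walsh M g K)"
      using that assms \<open>finite M\<close> by (intro walsh_inversion restrict_configs)
    also have "\<dots> = (\<Sum>K\<in>Pow M. par_sign K z * walsh M g K)"
      by (intro sum.cong refl arg_cong2[where f="(*)"] par_sign_cong) auto
    finally show ?thesis .
  qed
  then have "walsh N g L = walsh N (\<lambda>z. \<Sum>K\<in>Pow M. par_sign K z * walsh M g K) L"
    by (rule walsh_cong)
  also have "\<dots> = walsh M g L"
    using assms by (subst walsh_expansion) auto
  finally show ?thesis .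
qed

section \<open>Marginals of positive laws\<close>

lemma marginal_cong: "agree M x z \<Longrightarrow> marginal p M z = marginal p M x"
  by (simp add: marginal_def)

lemma conditional_eq: "conditional p A B x = marginal p (A \<union> B) x / marginal p B x"
  by (simp add: conditional_def marginal_def cond_prob_def ball_Un)

lemma marginal_sum:
  assumes "finite V" "p \<in> pos_dists V"
  shows "marginal p M x = (\<Sum>y | y \<in> configs V \<and> agree M x y. pmf p y)"
proof -
  have "set_pmf p = configs V" using assms by (simp add: pos_dists_def)
  then have "marginal p M x = measure p {y. y \<in> configs V \<and> agree M x y}"
    unfolding marginal_def by (intro measure_prob_cong_0) (auto simp: set_pmf_iff)
  then show ?thesis
    using finite_configs[OF assms(1)] by (simp add: measure_measure_pmf_finite)
qed

lemma pmf_pos: "p \<in> pos_dists V \<Longrightarrow> y \<in> configs V \<Longrightarrow> pmf p y > 0"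
  by (auto simp: pos_dists_def intro: pmf_positive)

lemma marginal_pos:
  assumes "finite V" "p \<in> pos_dists V" "M \<subseteq> V" "x \<in> configs M"
  shows "marginal p M x > 0"
proof -
  obtain z where "z \<in> configs V" "agree M x z"
    using configs_extend[OF assms(4,3)] .
  then show ?thesis
    unfolding marginal_sum[OF assms(1,2)] using assms
    by (intro sum_pos) (auto simp: finite_configs pmf_pos)
qed

lemma marginal_full:
  assumes "finite V" "p \<in> pos_dists V" "x \<in> configs V"
  shows "marginal p V x = pmf p x"
proof -
  have "{y. y \<in> configs V \<and> agree V x y} = {x}"
    using assms configs_eqI by blast
  then show ?thesis by (simp add: marginal_sum[OF assms(1,2)])
qed

text \<open>Group the configurations of \<open>V\<close> by their restriction to \<open>N\<close>.
  As \<open>M \<subseteq> N\<close>, that restriction already decides agreement with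
  \<open>x\<close> on \<open>M\<close>, so each group is kept or dropped as a whole.\<close>

lemma marginal_sum_marginals:
  assumes "finite V" "p \<in> pos_dists V" "N \<subseteq> V" "M \<subseteq> N"
  shows "marginal p M x = (\<Sum>z | z \<in> configs N \<and> agree M x z. marginal p N z)"
proof -
  have fN: "finite N" using assms finite_subset by blast
  have "(\<Sum>z | z \<in> configs N \<and> agree M x z. marginal p N z)
      = (\<Sum>z\<in>configs N. \<Sum>y | y \<in> configs V \<and> agree N z y. if agree M x y then pmf p y else 0)"
  proof (subst sum.inter_filter[OF finite_configs[OF fN]], rule sum.cong)
    fix z assume "z \<in> configs N"
    define c where "c \<longleftrightarrow> agree M x z"
    have eq: "agree M x y \<longleftrightarrow> c" if "agree N z y" for y
      using that assms(4) by (auto simp: subset_iff c_def)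
    have "(\<Sum>y | y \<in> configs V \<and> agree N z y. if agree M x y then pmf p y else 0)
        = (\<Sum>y | y \<in> configs V \<and> agree N z y. if c then pmf p y else 0)"
      by (intro sum.cong if_cong eq refl) simp
    then show "(if agree M x z then marginal p N z else 0)
        = (\<Sum>y | y \<in> configs V \<and> agree N z y. if agree M x y then pmf p y else 0)"
      unfolding c_def[symmetric] by (cases c) (simp_all add: marginal_sum[OF assms(1,2)])
  qed simp
  also have "\<dots> = marginal p M x"
    unfolding sum_configs_fibres[OF assms(1,3)] marginal_sum[OF assms(1,2)]
    by (rule sum.inter_filter[symmetric]) (simp add: finite_configs assms)
  finally show ?thesis by simp
qed

lemma ln_marginal_expansion:
  assumes "finite N" "x \<in> configs N"
  shows "ln (marginal p N x) = (\<Sum>K\<in>Pow N. par_sign K x * mll p N K)"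
  unfolding mll_walsh using assms by (rule walsh_inversion)

section \<open>Closure properties of smooth functions\<close>

lemma Ck_continuous: "Ck k I f \<Longrightarrow> continuous_on (I \<rightarrow>\<^sub>E UNIV) f"
  by (cases k) auto

lemma Ck_SucI:
  assumes "continuous_on (I \<rightarrow>\<^sub>E UNIV) f"
    and "\<And>i x. i \<in> I \<Longrightarrow> x \<in> I \<rightarrow>\<^sub>E UNIV \<Longrightarrow> ((\<lambda>t. f (x(i := t))) has_real_derivative g i x) (at (x i))"
    and "\<And>i. i \<in> I \<Longrightarrow> Ck k I (g i)"
  shows "Ck (Suc k) I f"
  using assms unfolding Ck.simps(2) has_partial_derivative_def by metis

lemma Ck_SucE:
  assumes "Ck (Suc k) I f"
  obtains g where
    "\<And>i x. i \<in> I \<Longrightarrow> x \<in> I \<rightarrow>\<^sub>E UNIV \<Longrightarrow> ((\<lambda>t. f (x(i := t))) has_real_derivative g i x) (at (x i))"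
    "\<And>i. i \<in> I \<Longrightarrow> Ck k I (g i)"
  using assms unfolding Ck.simps(2) has_partial_derivative_def by metis

text \<open>Serves the product, inverse and logarithm rules, whose derivatives contain
  undifferentiated factors that must be accepted one order lower.\<close>

lemma Ck_Suc_imp_Ck: "Ck (Suc k) I f \<Longrightarrow> Ck k I f"
proof (induction k arbitrary: f)
  case 0
  then show ?case using Ck_continuous by force
next
  case (Suc k)
  obtain g where g:
    "\<And>i x. i \<in> I \<Longrightarrow> x \<in> I \<rightarrow>\<^sub>E UNIV \<Longrightarrow> ((\<lambda>t. f (x(i := t))) has_real_derivative g i x) (at (x i))"
    "\<And>i. i \<in> I \<Longrightarrow> Ck (Suc k) I (g i)"
    by (rule Ck_SucE[OF Suc.prems]) (rule that; blast)
  show ?case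
    using Ck_continuous[OF Suc.prems] g(1) Suc.IH[OF g(2)] by (rule Ck_SucI)
qed

lemma Ck_const: "Ck k I (\<lambda>_. c)"
  by (induction k arbitrary: c) (auto intro!: Ck_SucI[where g="\<lambda>_ _. 0"] simp del: Ck.simps(2))

lemma Ck_add:
  assumes "Ck k I f" "Ck k I g"
  shows "Ck k I (\<lambda>x. f x + g x)"
  using assms
proof (induction k arbitrary: f g)
  case 0
  then show ?case by (simp add: continuous_on_add)
next
  case (Suc k)
  obtain f' where f':
    "\<And>i x. i \<in> I \<Longrightarrow> x \<in> I \<rightarrow>\<^sub>E UNIV \<Longrightarrow> ((\<lambda>t. f (x(i := t))) has_real_derivative f' i x) (at (x i))"
    "\<And>i. i \<in> I \<Longrightarrow> Ck k I (f' i)"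
    by (rule Ck_SucE[OF Suc.prems(1)]) (rule that; blast)
  obtain g' where g':
    "\<And>i x. i \<in> I \<Longrightarrow> x \<in> I \<rightarrow>\<^sub>E UNIV \<Longrightarrow> ((\<lambda>t. g (x(i := t))) has_real_derivative g' i x) (at (x i))"
    "\<And>i. i \<in> I \<Longrightarrow> Ck k I (g' i)"
    by (rule Ck_SucE[OF Suc.prems(2)]) (rule that; blast)
  show ?case
  proof (rule Ck_SucI)
    show "continuous_on (I \<rightarrow>\<^sub>E UNIV) (\<lambda>x. f x + g x)"
      using Suc.prems by (intro continuous_on_add Ck_continuous)
    fix i assume "i \<in> I"
    then show "Ck k I (\<lambda>x. f' i x + g' i x)"
      using f'(2) g'(2) by (intro Suc.IH)
    fix x :: "'a \<Rightarrow> real" assume "x \<in> I \<rightarrow>\<^sub>E UNIV"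
    with \<open>i \<in> I\<close> show "((\<lambda>t. f (x(i := t)) + g (x(i := t))) has_real_derivative f' i x + g' i x) (at (x i))"
      using f'(1) g'(1) by (intro DERIV_add)
  qed
qed

lemma Ck_mult:
  assumes "Ck k I f" "Ck k I g"
  shows "Ck k I (\<lambda>x. f x * g x)"
  using assms
proof (induction k arbitrary: f g)
  case 0
  then show ?case by (simp add: continuous_on_mult)
next
  case (Suc k)
  obtain f' where f':
    "\<And>i x. i \<in> I \<Longrightarrow> x \<in> I \<rightarrow>\<^sub>E UNIV \<Longrightarrow> ((\<lambda>t. f (x(i := t))) has_real_derivative f' i x) (at (x i))"
    "\<And>i. i \<in> I \<Longrightarrow> Ck k I (f' i)"
    by (rule Ck_SucE[OF Suc.prems(1)]) (rule that; blast)
  obtain g' where g':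
    "\<And>i x. i \<in> I \<Longrightarrow> x \<in> I \<rightarrow>\<^sub>E UNIV \<Longrightarrow> ((\<lambda>t. g (x(i := t))) has_real_derivative g' i x) (at (x i))"
    "\<And>i. i \<in> I \<Longrightarrow> Ck k I (g' i)"
    by (rule Ck_SucE[OF Suc.prems(2)]) (rule that; blast)
  show ?case
  proof (rule Ck_SucI)
    show "continuous_on (I \<rightarrow>\<^sub>E UNIV) (\<lambda>x. f x * g x)"
      using Suc.prems by (intro continuous_on_mult Ck_continuous)
    fix i assume "i \<in> I"
    then show "Ck k I (\<lambda>x. f' i x * g x + g' i x * f x)"
      using Suc.prems[THEN Ck_Suc_imp_Ck] f'(2) g'(2) by (intro Ck_add Suc.IH)
    fix x :: "'a \<Rightarrow> real" assume "x \<in> I \<rightarrow>\<^sub>E UNIV"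
    with \<open>i \<in> I\<close> show "((\<lambda>t. f (x(i := t)) * g (x(i := t))) has_real_derivative f' i x * g x + g' i x * f x) (at (x i))"
      using DERIV_mult[OF f'(1)[of i x] g'(1)[of i x]] by simp
  qed
qed

lemma Ck_sum: "(\<And>j. j \<in> J \<Longrightarrow> Ck k I (f j)) \<Longrightarrow> Ck k I (\<lambda>x. \<Sum>j\<in>J. f j x)"
  by (induction J rule: infinite_finite_induct) (auto simp: Ck_const Ck_add)

text \<open>The derivative is built from \<open>inverse (f x)\<close> itself and \<open>f'\<close>,
  so the induction hypothesis is used for the same \<open>f\<close> at the lower order.\<close>

lemma Ck_inverse:
  assumes "Ck k I f" and nz: "\<And>x. x \<in> I \<rightarrow>\<^sub>E UNIV \<Longrightarrow> f x \<noteq> 0"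
  shows "Ck k I (\<lambda>x. inverse (f x))"
  using assms(1)
proof (induction k)
  case 0
  then show ?case using nz by (simp add: continuous_on_inverse)
next
  case (Suc k)
  obtain f' where f':
    "\<And>i x. i \<in> I \<Longrightarrow> x \<in> I \<rightarrow>\<^sub>E UNIV \<Longrightarrow> ((\<lambda>t. f (x(i := t))) has_real_derivative f' i x) (at (x i))"
    "\<And>i. i \<in> I \<Longrightarrow> Ck k I (f' i)"
    by (rule Ck_SucE[OF Suc.prems]) (rule that; blast)
  show ?case
  proof (rule Ck_SucI)
    show "continuous_on (I \<rightarrow>\<^sub>E UNIV) (\<lambda>x. inverse (f x))"
      using nz by (intro continuous_on_inverse Ck_continuous[OF Suc.prems]) auto
    fix i assume "i \<in> I"
    then show "Ck k I (\<lambda>x. (-1) * (inverse (f x) * f' i x * inverse (f x)))"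
      using Suc.IH[OF Ck_Suc_imp_Ck[OF Suc.prems]] f'(2) by (intro Ck_mult Ck_const)
    fix x :: "'a \<Rightarrow> real" assume "x \<in> I \<rightarrow>\<^sub>E UNIV"
    with \<open>i \<in> I\<close> show "((\<lambda>t. inverse (f (x(i := t)))) has_real_derivative
        (-1) * (inverse (f x) * f' i x * inverse (f x))) (at (x i))"
      using DERIV_inverse'[OF f'(1)[of i x]] nz[of x] by simp
  qed
qed

text \<open>One differentiation removes the logarithm: the derivative is a product of
  \<open>inverse (f x)\<close> and \<open>f'\<close>, so a case distinction on \<open>k\<close>
  replaces induction.\<close>

lemma Ck_ln:
  assumes f: "Ck k I f" and pos: "\<And>x. x \<in> I \<rightarrow>\<^sub>E UNIV \<Longrightarrow> f x > 0"
  shows "Ck k I (\<lambda>x. ln (f x))"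
proof -
  have nz: "f x \<noteq> 0" if "x \<in> I \<rightarrow>\<^sub>E UNIV" for x
    using pos[OF that] by simp
  have cont: "continuous_on (I \<rightarrow>\<^sub>E UNIV) (\<lambda>x. ln (f x))"
    using nz by (intro continuous_on_ln Ck_continuous[OF f]) auto
  show ?thesis
  proof (cases k)
    case 0
    then show ?thesis using cont by simp
  next
    case (Suc m)
    have f_Suc: "Ck (Suc m) I f" using f Suc by simp
    obtain f' where f':
      "\<And>i x. i \<in> I \<Longrightarrow> x \<in> I \<rightarrow>\<^sub>E UNIV \<Longrightarrow> ((\<lambda>t. f (x(i := t))) has_real_derivative f' i x) (at (x i))"
      "\<And>i. i \<in> I \<Longrightarrow> Ck m I (f' i)"
      by (rule Ck_SucE[OF f_Suc]) (rule that; blast)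
    show ?thesis
      unfolding Suc
    proof (rule Ck_SucI[OF cont])
      fix i assume "i \<in> I"
      then show "Ck m I (\<lambda>x. inverse (f x) * f' i x)"
        using Ck_inverse[OF Ck_Suc_imp_Ck[OF f_Suc] nz] f'(2) by (intro Ck_mult)
      fix x :: "'a \<Rightarrow> real" assume "x \<in> I \<rightarrow>\<^sub>E UNIV"
      with \<open>i \<in> I\<close> show "((\<lambda>t. ln (f (x(i := t)))) has_real_derivative inverse (f x) * f' i x) (at (x i))"
        using DERIV_chain2[OF DERIV_ln f'(1)[of i x]] pos[of x] by simp
    qed
  qed
qed

text \<open>Each partial derivative is a constant multiple of the function itself, so the induction
  closes on a single function.\<close>

lemma Ck_exp_linear:
  assumes "finite I"
  shows "Ck k I (\<lambda>x. exp (\<Sum>j\<in>I. c j * x j))"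
proof (induction k)
  case 0
  have "continuous_on UNIV (\<lambda>x::'a \<Rightarrow> real. exp (\<Sum>j\<in>I. c j * x j))"
    by (intro continuous_on_exp continuous_on_sum continuous_on_mult_left continuous_on_product_coordinates)
  then show ?case by (auto intro: continuous_on_subset)
next
  case (Suc k)
  show ?case
  proof (rule Ck_SucI)
    show "continuous_on (I \<rightarrow>\<^sub>E UNIV) (\<lambda>x. exp (\<Sum>j\<in>I. c j * x j))"
      using Suc.IH by (rule Ck_continuous)
    fix i assume i: "i \<in> I"
    show "Ck k I (\<lambda>x. c i * exp (\<Sum>j\<in>I. c j * x j))"
      by (intro Ck_mult Ck_const Suc.IH)
    fix x :: "'a \<Rightarrow> real"
    \<comment> \<open>Isolating coordinate \<open>i\<close> makes the exponent affine in
      \<open>t\<close>.\<close>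
    have upd: "(\<Sum>j\<in>I. c j * (x(i := t)) j) = c i * t + (\<Sum>j\<in>I - {i}. c j * x j)" for t
      using assms i by (subst sum.remove[of I i]) auto
    have "((\<lambda>t. exp (c i * t + (\<Sum>j\<in>I - {i}. c j * x j))) has_real_derivative
        c i * exp (c i * x i + (\<Sum>j\<in>I - {i}. c j * x j))) (at (x i))"
      by (auto intro!: derivative_eq_intros)
    then show "((\<lambda>t. exp (\<Sum>j\<in>I. c j * (x(i := t)) j)) has_real_derivative
        c i * exp (\<Sum>j\<in>I. c j * x j)) (at (x i))"
      unfolding upd using upd[of "x i"] by simp
  qed
qed

section \<open>The normalizing constant of the conditional law\<close>

text \<open>The sum runs over the choices of x_A for a fixed x_M. The parameters form a free vector
  \<open>\<theta>\<close>, because smoothness is required on the whole coordinate space and not only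
  at vectors that come from a law.\<close>

definition cond_partition :: "'v set \<Rightarrow> 'v set \<Rightarrow> ('v \<Rightarrow> nat) \<Rightarrow> ('v set \<Rightarrow> real) \<Rightarrow> real" where
  "cond_partition A M x \<theta> =
     (\<Sum>z | z \<in> configs (M \<union> A) \<and> agree M x z. exp (\<Sum>K\<in>cond_indices A M. par_sign K z * \<theta> K))"

lemma cond_partition_pos:
  assumes "finite A" "finite M" "x \<in> configs M"
  shows "cond_partition A M x \<theta> > 0"
proof -
  obtain z where "z \<in> configs (M \<union> A)" "agree M x z"
    using configs_extend[OF assms(3) sup_ge1] .
  then show ?thesis
    unfolding cond_partition_def using assms by (intro sum_pos) (auto simp: finite_configs)
qed

lemma finite_cond_indices: "finite A \<Longrightarrow> finite M \<Longrightarrow> finite (cond_indices A M)"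
  by (rule finite_subset[of _ "Pow (A \<union> M)"]) (auto simp: cond_indices_def)

text \<open>The minus sign arises because ln Z is added to the log-marginal over \<open>M\<close>,
  whereas the shift leads from \<open>M\<close> to \<open>M \<union> A\<close>.\<close>

definition param_shift :: "'v set \<Rightarrow> 'v set \<Rightarrow> 'v set \<Rightarrow> ('v set \<Rightarrow> real) \<Rightarrow> real" where
  "param_shift A M L \<theta> = - walsh M (\<lambda>x. ln (cond_partition A M x \<theta>)) L"

text \<open>A sum of exponentials of linear forms is smooth, and its positivity at every
  \<open>\<theta>\<close> lets the logarithm preserve this.\<close>

lemma smooth_param_shift:
  assumes "finite A" "finite M"
  shows "smooth (cond_indices A M) (param_shift A M L)"
  unfolding smooth_def
proof
  fix k
  have "Ck k (cond_indices A M)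
      (\<lambda>\<theta>. (- 1 / 2 ^ card M) * (\<Sum>x\<in>configs M. par_sign L x * ln (cond_partition A M x \<theta>)))"
  proof (rule Ck_mult[OF Ck_const], rule Ck_sum, rule Ck_mult[OF Ck_const], rule Ck_ln)
    fix x :: "'a \<Rightarrow> nat" assume "x \<in> configs M"
    then show "cond_partition A M x \<theta> > 0" for \<theta>
      using assms by (intro cond_partition_pos)
    show "Ck k (cond_indices A M) (\<lambda>\<theta>. cond_partition A M x \<theta>)"
      unfolding cond_partition_def
      by (rule Ck_sum, rule Ck_exp_linear[OF finite_cond_indices[OF assms]])
  qed
  moreover have "param_shift A M L
      = (\<lambda>\<theta>. (- 1 / 2 ^ card M) * (\<Sum>x\<in>configs M. par_sign L x * ln (cond_partition A M x \<theta>)))"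
    by (simp add: param_shift_def walsh_def fun_eq_iff)
  ultimately show "Ck k (cond_indices A M) (param_shift A M L)" by simp
qed

section \<open>Comparison of the parameters over \<open>M\<close> and over
  \<open>M \<union> A\<close>\<close>

lemma mll_eq_param_shift:
  assumes "finite V" "p \<in> pos_dists V" "A \<union> M \<subseteq> V" "A \<inter> M = {}" "L \<subseteq> M"
  shows "mll p (M \<union> A) L = mll p M L + param_shift A M L (cond_params p A M)"
proof -
  have fin: "finite A" "finite M" using assms finite_subset by auto
  let ?N = "M \<union> A" and ?\<theta> = "cond_params p A M"
  have "ln (marginal p M x) = (\<Sum>K\<in>Pow M. par_sign K x * mll p ?N K) + ln (cond_partition A M x ?\<theta>)"
    if x: "x \<in> configs M" for x
  proof -
    \<comment> \<open>The factor from sets \<open>K \<subseteq> M\<close> is the same for all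
      extensions \<open>z\<close> of \<open>x\<close>, so it can be pulled out of the sum over x_A;
      the second factors sum to the partition function.\<close>
    have "marginal p ?N z = exp (\<Sum>K\<in>Pow M. par_sign K x * mll p ?N K)
        * exp (\<Sum>K\<in>cond_indices A M. par_sign K z * ?\<theta> K)"
      if z: "z \<in> configs ?N" "agree M x z" for z
    proof -
      have "marginal p ?N z = exp (\<Sum>K\<in>Pow ?N. par_sign K z * mll p ?N K)"
        using marginal_pos[of V p ?N z] z assms fin
        by (subst ln_marginal_expansion[symmetric]) auto
      also have "Pow ?N = Pow M \<union> cond_indices A M"
        by (auto simp: cond_indices_def)
      also have "(\<Sum>K\<in>Pow M \<union> cond_indices A M. par_sign K z * mll p ?N K)
          = (\<Sum>K\<in>Pow M. par_sign K z * mll p ?N K)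
            + (\<Sum>K\<in>cond_indices A M. par_sign K z * mll p ?N K)"
        using fin assms(4)
        by (intro sum.union_disjoint finite_cond_indices) (auto simp: cond_indices_def)
      also have "(\<Sum>K\<in>Pow M. par_sign K z * mll p ?N K) = (\<Sum>K\<in>Pow M. par_sign K x * mll p ?N K)"
        using z(2) by (intro sum.cong refl arg_cong2[where f="(*)"] par_sign_cong) auto
      also have "(\<Sum>K\<in>cond_indices A M. par_sign K z * mll p ?N K)
          = (\<Sum>K\<in>cond_indices A M. par_sign K z * ?\<theta> K)"
        by (simp add: cond_params_def)
      finally show ?thesis by (simp add: exp_add)
    qed
    then have "marginal p M x
        = exp (\<Sum>K\<in>Pow M. par_sign K x * mll p ?N K) * cond_partition A M x ?\<theta>"
      using assms by (subst marginal_sum_marginals[of V p ?N])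
        (auto simp: cond_partition_def sum_distrib_left)
    then show ?thesis
      using cond_partition_pos[OF fin x, of ?\<theta>] by (simp add: ln_mult)
  qed
  then have "mll p M L = walsh M (\<lambda>x. (\<Sum>K\<in>Pow M. par_sign K x * mll p ?N K)
      + ln (cond_partition A M x ?\<theta>)) L"
    unfolding mll_walsh[of p M L] by (rule walsh_cong)
  \<comment> \<open>The first sum is an expansion over \<open>Pow M\<close> with coefficients
    \<open>mll p ?N K\<close>, so its coefficient at \<open>L \<subseteq> M\<close> is
    \<open>mll p ?N L\<close>.\<close>
  also have "\<dots> = mll p ?N L - param_shift A M L ?\<theta>"
    using fin assms(5) by (simp add: walsh_add walsh_expansion param_shift_def)
  finally show ?thesis by simp
qed

text \<open>The difference of the two parameters is the coefficient at \<open>L\<close> of ln p(x_A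
  | x_M). Under the independence this equals ln p(x_A | x_{M - v}), which ignores x_v, and
  \<open>v \<in> L\<close> makes the coefficient vanish.\<close>

lemma mll_eq_if_cond_indep:
  assumes "finite V" "p \<in> pos_dists V" "A \<union> M \<subseteq> V" "A \<inter> M = {}" "L \<subseteq> M"
    and "v \<in> L" and ci: "cond_indep p A {v} (M - {v})"
  shows "mll p (M \<union> A) L = mll p M L"
proof -
  let ?N = "M \<union> A"
  have fN: "finite ?N" using assms finite_subset by auto
  have "v \<in> M" using assms by auto
  have eq: "ln (marginal p ?N z) - ln (marginal p M z)
      = ln (marginal p (?N - {v}) z) - ln (marginal p (M - {v}) z)" if z: "z \<in> configs ?N" for z
  proof -
    have pos: "marginal p S z > 0" if "S \<subseteq> ?N" for S
    proof -
      have "marginal p S z = marginal p S (restrict z S)"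
        by (rule marginal_cong) simp
      then show ?thesis
        using marginal_pos[OF assms(1,2), of S] restrict_configs[OF z that] that assms(3)
        by (simp add: le_sup_iff subset_trans)
    qed
    have sets: "A \<union> {v} \<union> (M - {v}) = ?N" "A \<union> (M - {v}) = ?N - {v}" "{v} \<union> (M - {v}) = M"
      using assms(4) \<open>v \<in> M\<close> by auto
    \<comment> \<open>The independence at \<open>z\<close>, written with marginals. Clearing
      denominators and taking logarithms turns it into an additive identity.\<close>
    have "marginal p ?N z / marginal p (M - {v}) z
        = (marginal p (?N - {v}) z / marginal p (M - {v}) z) * (marginal p M z / marginal p (M - {v}) z)"
      using ci by (simp only: cond_indep_def conditional_eq sets)
    moreover have "marginal p (M - {v}) z \<noteq> 0"
      using pos[OF le_supI1[OF Diff_subset], of "{v}"] by simp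
    ultimately have "ln (marginal p ?N z * marginal p (M - {v}) z) = ln (marginal p (?N - {v}) z * marginal p M z)"
      by (simp add: field_simps)
    then have "ln (marginal p ?N z) + ln (marginal p (M - {v}) z)
        = ln (marginal p (?N - {v}) z) + ln (marginal p M z)"
      using pos[of ?N] pos[of "M - {v}"] pos[of "?N - {v}"] pos[of M]
      by (simp add: ln_mult le_supI1)
    then show ?thesis by simp
  qed
  \<comment> \<open>Lifting the smaller margin to \<open>?N\<close> lets both parameters be
    subtracted inside one transform.\<close>
  have "mll p M L = walsh ?N (\<lambda>x. ln (marginal p M x)) L"
    unfolding mll_walsh using fN assms(5)
    by (intro walsh_superset[symmetric] arg_cong[where f=ln] marginal_cong) auto
  then have "mll p ?N L - mll p M L
      = walsh ?N (\<lambda>x. ln (marginal p ?N x) - ln (marginal p M x)) L"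
    by (simp add: mll_walsh walsh_diff)
  also have "\<dots> = walsh ?N (\<lambda>x. ln (marginal p (?N - {v}) x) - ln (marginal p (M - {v}) x)) L"
    by (rule walsh_cong) (rule eq)
  also have "\<dots> = 0"
  proof (rule walsh_independent_eq_0[OF fN _ \<open>v \<in> L\<close>])
    fix x y :: "'a \<Rightarrow> nat" assume "agree (?N - {v}) x y"
    then show "ln (marginal p (?N - {v}) y) - ln (marginal p (M - {v}) y)
        = ln (marginal p (?N - {v}) x) - ln (marginal p (M - {v}) x)"
      using marginal_cong[of "?N - {v}" x y p] marginal_cong[of "M - {v}" x y p] by auto
  qed (use assms in auto)
  finally show ?thesis by simp
qed

section \<open>Log-linear coordinates\<close>

lemma normalized_pmf_exists:
  assumes "finite V" "\<And>x. x \<in> configs V \<Longrightarrow> w x > 0"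
  obtains q where "q \<in> pos_dists V"
    "\<And>x. x \<in> configs V \<Longrightarrow> pmf q x = w x / (\<Sum>y\<in>configs V. w y)"
proof -
  let ?Z = "\<Sum>y\<in>configs V. w y"
  have Z: "?Z > 0" using assms configs_nonempty by (intro sum_pos) (auto simp: finite_configs)
  let ?f = "\<lambda>x. if x \<in> configs V then w x / ?Z else 0"
  have nonneg: "0 \<le> ?f x" for x
    using assms(2)[of x] Z by auto
  have "(\<integral>\<^sup>+x. ennreal (?f x) \<partial>count_space UNIV) = (\<Sum>x\<in>configs V. ennreal (?f x))"
    using assms by (intro nn_integral_count_space') (auto simp: finite_configs)
  also have "\<dots> = ennreal (\<Sum>x\<in>configs V. ?f x)"
    using nonneg by (intro sum_ennreal)
  also have "(\<Sum>x\<in>configs V. ?f x) = 1"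
    using Z by (simp flip: sum_divide_distrib)
  finally have prob: "(\<integral>\<^sup>+x. ennreal (?f x) \<partial>count_space UNIV) = 1" by simp
  show thesis
  proof
    show "embed_pmf ?f \<in> pos_dists V"
      using assms(2) Z by (auto simp: pos_dists_def set_embed_pmf[OF nonneg prob] less_le)
    show "pmf (embed_pmf ?f) x = w x / ?Z" if "x \<in> configs V" for x
      using that by (simp add: pmf_embed_pmf[OF nonneg prob])
  qed
qed

text \<open>Equal coordinates leave only the coefficient at the empty set free, so the two mass
  functions are proportional; both have total mass 1, which forces the factor to be 1.\<close>

lemma inj_on_eta_coords:
  assumes "finite V"
  shows "inj_on (eta_coords V) (pos_dists V)"
proof (rule inj_onI)
  fix p q assume p: "p \<in> pos_dists V" and q: "q \<in> pos_dists V" and eq: "eta_coords V p = eta_coords V q"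
  have mll: "mll p V J = mll q V J" if "J \<subseteq> V" "J \<noteq> {}" for J
    using fun_cong[OF eq, of J] that by (simp add: eta_coords_def)
  let ?c = "exp (mll p V {} - mll q V {})"
  have scale: "pmf p x = ?c * pmf q x" if x: "x \<in> configs V" for x
  proof -
    have "ln (pmf r x) = mll r V {} + (\<Sum>K\<in>Pow V - {{}}. par_sign K x * mll r V K)"
      if "r \<in> pos_dists V" for r
      using ln_marginal_expansion[OF assms x, of r] marginal_full[OF assms that x] assms
      by (simp add: sum.remove[of "Pow V" "{}"])
    from this[OF p] this[OF q] have "ln (pmf p x) = (mll p V {} - mll q V {}) + ln (pmf q x)"
      using mll by simp
    then have "exp (ln (pmf p x)) = ?c * exp (ln (pmf q x))"
      by (simp only: exp_add)
    then show ?thesis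
      using pmf_pos[OF p x] pmf_pos[OF q x] by simp
  qed
  have total: "(\<Sum>x\<in>configs V. pmf r x) = 1" if "r \<in> pos_dists V" for r
    using that assms by (intro sum_pmf_eq_1) (auto simp: pos_dists_def finite_configs)
  have "(\<Sum>x\<in>configs V. pmf p x) = ?c * (\<Sum>x\<in>configs V. pmf q x)"
    by (simp add: scale sum_distrib_left)
  then have "?c = 1" using total p q by simp
  show "p = q"
  proof (rule pmf_eqI)
    fix x show "pmf p x = pmf q x"
    proof (cases "x \<in> configs V")
      case True
      then show ?thesis using scale \<open>?c = 1\<close> by simp
    next
      case False
      then have "x \<notin> set_pmf p" "x \<notin> set_pmf q" using p q by (simp_all add: pos_dists_def)
      then show ?thesis by (metis pmf_eq_0_set_pmf)
    qed
  qed
qed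

text \<open>The tilted law is written down explicitly. Its log-mass gains
  \<open>s * par_sign K\<close>, which moves only the coefficient at \<open>K\<close>, and loses the
  constant ln Z, which touches only the coefficient at the empty set. Injectivity then identifies it
  as the value of the inverse map.\<close>

lemma dist_of_eta_tilt:
  assumes "finite V" "p \<in> pos_dists V" "K \<subseteq> V" "K \<noteq> {}"
  obtains Z where "Z > 0" "dist_of_eta V ((eta_coords V p)(K := eta_coords V p K + s)) \<in> pos_dists V"
    "\<And>x. x \<in> configs V \<Longrightarrow>
      pmf (dist_of_eta V ((eta_coords V p)(K := eta_coords V p K + s))) x
        = pmf p x * exp (s * par_sign K x) / Z"
proof -
  let ?w = "\<lambda>x. pmf p x * exp (s * par_sign K x)"
  let ?Z = "\<Sum>x\<in>configs V. ?w x"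
  have w: "?w x > 0" if "x \<in> configs V" for x
    using pmf_pos[OF assms(2) that] by simp
  then have Z: "?Z > 0" using assms configs_nonempty by (intro sum_pos) (auto simp: finite_configs)
  obtain q where q: "q \<in> pos_dists V" "\<And>x. x \<in> configs V \<Longrightarrow> pmf q x = ?w x / ?Z"
    using normalized_pmf_exists[of V ?w] assms(1) w by blast
  have "mll q V J = mll p V J + (if J = K then s else 0)" if J: "J \<subseteq> V" "J \<noteq> {}" for J
  proof -
    have "mll q V J = walsh V (\<lambda>x. ln (marginal p V x) + s * par_sign K x - ln ?Z) J"
      unfolding mll_walsh
    proof (rule walsh_cong)
      fix x assume x: "x \<in> configs V"
      have "ln (?w x / ?Z) = ln (pmf p x) + s * par_sign K x - ln ?Z"
        using pmf_pos[OF assms(2) x] Z w[OF x] by (simp add: ln_div ln_mult)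
      then show "ln (marginal q V x) = ln (marginal p V x) + s * par_sign K x - ln ?Z"
        using x q assms by (simp add: marginal_full)
    qed
    also have "\<dots> = mll p V J + (if J = K then s else 0)"
      using assms J by (simp add: walsh_diff walsh_add walsh_cmult walsh_const walsh_par_sign mll_walsh)
    finally show ?thesis .
  qed
  then have "eta_coords V q = (eta_coords V p)(K := eta_coords V p K + s)"
    using assms by (auto simp: eta_coords_def fun_eq_iff)
  then have "dist_of_eta V ((eta_coords V p)(K := eta_coords V p K + s)) = q"
    unfolding dist_of_eta_def using q(1) by (intro the_inv_into_f_eq inj_on_eta_coords assms)
  then show thesis using that[OF Z] q by simp
qed

text \<open>The normalizer \<open>Z\<close> varies with \<open>s\<close>, but it divides every fibre
  sum alike and becomes an additive constant with coefficient 0 at nonempty \<open>L\<close>. The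
  remaining expression depends on \<open>s\<close> only through the exponentials.\<close>

lemma mll_dist_of_eta_tilt:
  assumes "finite V" "p \<in> pos_dists V" "K \<subseteq> V" "K \<noteq> {}" "M \<subseteq> V" "L \<subseteq> M" "L \<noteq> {}"
  shows "mll (dist_of_eta V ((eta_coords V p)(K := eta_coords V p K + s))) M L
    = walsh M (\<lambda>x. ln (\<Sum>z | z \<in> configs V \<and> agree M x z. pmf p z * exp (s * par_sign K z))) L"
proof -
  have fM: "finite M" using assms finite_subset by blast
  define q where "q = dist_of_eta V ((eta_coords V p)(K := eta_coords V p K + s))"
  obtain Z where Z: "Z > 0" and q: "q \<in> pos_dists V"
    "\<And>x. x \<in> configs V \<Longrightarrow> pmf q x = pmf p x * exp (s * par_sign K x) / Z"
    using dist_of_eta_tilt[OF assms(1-4)] unfolding q_def by blast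
  let ?S = "\<lambda>x. \<Sum>z | z \<in> configs V \<and> agree M x z. pmf p z * exp (s * par_sign K z)"
  have "mll q M L = walsh M (\<lambda>x. ln (?S x) - ln Z) L"
    unfolding mll_walsh
  proof (rule walsh_cong)
    fix x assume x: "x \<in> configs M"
    have "marginal q M x = ?S x / Z"
      unfolding marginal_sum[OF assms(1) q(1)] by (simp add: q(2) sum_divide_distrib)
    moreover have "marginal q M x > 0"
      using x assms q by (intro marginal_pos)
    ultimately show "ln (marginal q M x) = ln (?S x) - ln Z"
      using Z by (simp add: ln_div zero_less_divide_iff)
  qed
  then show ?thesis
    using fM assms by (simp add: walsh_diff walsh_const q_def)
qed

section \<open>The derivative along a coordinate axis\<close>

lemma conditional_complement:
  assumes "finite V" "p \<in> pos_dists V" "M \<subseteq> V" "z \<in> configs V"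
  shows "conditional p (V - M) M z = pmf p z / marginal p M z"
proof -
  have "V - M \<union> M = V" using assms by auto
  then show ?thesis using assms by (simp add: conditional_eq marginal_full)
qed

lemma mll_partial_derivative:
  fixes K L M V :: "'v set"
  assumes "finite V" "p \<in> pos_dists V" "K \<subseteq> V" "K \<noteq> {}" "M \<subseteq> V" "L \<subseteq> M" "L \<noteq> {}"
  shows "has_partial_derivative (\<lambda>\<eta>. mll (dist_of_eta V \<eta>) M L) K
    ((\<Sum>x\<in>configs V. par_sign (sym_diff K L) x * conditional p (V - M) M x) / 2 ^ card M)
    (eta_coords V p)"
proof -
  have fK: "finite K" using assms(3,1) by (rule finite_subset)
  have fL: "finite L" using subset_trans[OF assms(6,5)] assms(1) by (rule finite_subset)
  let ?\<eta> = "eta_coords V p K"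
  let ?F = "\<lambda>x. {z. z \<in> configs V \<and> agree M x z}"
  \<comment> \<open>The conditional mean of \<open>par_sign K\<close> given X_M = x: the derivative
    of the log-sum at tilt 0, where the inner sum is the marginal itself.\<close>
  let ?D = "\<lambda>x. (\<Sum>z\<in>?F x. pmf p z * par_sign K z) / marginal p M x"
  have deriv: "((\<lambda>t. ln (\<Sum>z\<in>?F x. pmf p z * exp ((t - ?\<eta>) * par_sign K z)))
      has_real_derivative ?D x) (at ?\<eta>)" if x: "x \<in> configs M" for x
    using marginal_pos[OF assms(1,2,5) x] unfolding marginal_sum[OF assms(1,2)]
    by (auto intro!: derivative_eq_intros simp: mult.commute)
  \<comment> \<open>Setting the coordinate at \<open>K\<close> to \<open>t\<close> is a tilt by
    \<open>t - ?\<eta>\<close> from the base point.\<close>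
  have along_axis: "mll (dist_of_eta V ((eta_coords V p)(K := t))) M L
      = (\<Sum>x\<in>configs M. par_sign L x * ln (\<Sum>z\<in>?F x. pmf p z * exp ((t - ?\<eta>) * par_sign K z)))
        / 2 ^ card M" for t
    using mll_dist_of_eta_tilt[OF assms, of "t - ?\<eta>"] by (simp add: walsh_def)
  have "((\<lambda>t. mll (dist_of_eta V ((eta_coords V p)(K := t))) M L)
      has_real_derivative (\<Sum>x\<in>configs M. par_sign L x * ?D x) / 2 ^ card M) (at ?\<eta>)"
    unfolding along_axis by (intro DERIV_cdivide DERIV_sum DERIV_cmult deriv)
  also have "(\<Sum>x\<in>configs M. par_sign L x * ?D x)
      = (\<Sum>x\<in>configs M. \<Sum>z\<in>?F x. par_sign (sym_diff K L) z * conditional p (V - M) M z)"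
  proof (rule sum.cong)
    fix x assume "x \<in> configs M"
    \<comment> \<open>Since \<open>L \<subseteq> M\<close>, both \<open>par_sign L\<close> and the
      marginal are constant on the fibre over \<open>x\<close>; the two signs merge into that of the
      symmetric difference.\<close>
    have "par_sign (sym_diff K L) z * conditional p (V - M) M z
        = par_sign L x * (pmf p z * par_sign K z / marginal p M x)" if "z \<in> ?F x" for z
    proof -
      have "par_sign L z = par_sign L x" "marginal p M z = marginal p M x"
        using that assms(6) by (auto intro!: par_sign_cong marginal_cong)
      then show ?thesis
        using that assms by (simp add: par_sign_sym_diff[OF fK fL] conditional_complement)
    qed
    then show "par_sign L x * ?D x
        = (\<Sum>z\<in>?F x. par_sign (sym_diff K L) z * conditional p (V - M) M z)"
      by (simp add: sum_distrib_left sum_divide_distrib)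
  qed simp
  also have "\<dots> = (\<Sum>z\<in>configs V. par_sign (sym_diff K L) z * conditional p (V - M) M z)"
    using assms by (intro sum_configs_fibres)
  finally show ?thesis
    unfolding has_partial_derivative_def .
qed

theorem theorem3p1:
  fixes A M L :: "'v set"
  assumes "finite A" and "finite M" and "A \<inter> M = {}" and "L \<subseteq> M"
  shows "(\<exists>f. smooth (cond_indices A M) f \<and>
            (\<forall>V p. finite V \<and> A \<union> M \<subseteq> V \<and> p \<in> pos_dists V \<longrightarrow>
               mll p (M \<union> A) L = mll p M L + f (cond_params p A M) \<and>
               ((\<exists>v\<in>L. cond_indep p A {v} (M - {v})) \<longrightarrow> f (cond_params p A M) = 0)))
         \<and>
         (L \<noteq> {} \<longrightarrow>
            (\<forall>V p K. finite V \<and> A \<union> M \<subseteq> V \<and> p \<in> pos_dists V \<and> K \<subseteq> V \<and> K \<inter> (V - M) \<noteq> {} \<longrightarrow>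
               has_partial_derivative (\<lambda>\<eta>. mll (dist_of_eta V \<eta>) M L) K
                 ((\<Sum>x\<in>configs V. par_sign (sym_diff K L) x * conditional p (V - M) M x) / 2 ^ card M)
                 (eta_coords V p)))"
proof (intro conjI impI allI exI[of _ "param_shift A M L"])
  \<comment> \<open>The witness is fixed before \<open>V\<close> and \<open>p\<close>, so it depends
    on \<open>A\<close>, \<open>M\<close> and \<open>L\<close> alone.\<close>
  show "smooth (cond_indices A M) (param_shift A M L)"
    using assms by (intro smooth_param_shift)
next
  fix V p
  assume Vp: "finite V \<and> A \<union> M \<subseteq> V \<and> p \<in> pos_dists V"
  then show eq: "mll p (M \<union> A) L = mll p M L + param_shift A M L (cond_params p A M)"
    using assms by (intro mll_eq_param_shift[of V]) auto
  assume "\<exists>v\<in>L. cond_indep p A {v} (M - {v})"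
  then have "mll p (M \<union> A) L = mll p M L"
    using Vp assms mll_eq_if_cond_indep by metis
  with eq show "param_shift A M L (cond_params p A M) = 0" by simp
next
  fix V p K
  assume "L \<noteq> {}" and "finite V \<and> A \<union> M \<subseteq> V \<and> p \<in> pos_dists V \<and> K \<subseteq> V \<and> K \<inter> (V - M) \<noteq> {}"
  \<comment> \<open>A set meeting \<open>V - M\<close> is nonempty, so \<open>K\<close> indexes one
    of the coordinates.\<close>
  then show "has_partial_derivative (\<lambda>\<eta>. mll (dist_of_eta V \<eta>) M L) K
      ((\<Sum>x\<in>configs V. par_sign (sym_diff K L) x * conditional p (V - M) M x) / 2 ^ card M)
      (eta_coords V p)"
    using assms by (intro mll_partial_derivative) auto
qed

end
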